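(* Assume ${\rm GBC}^-$. The principle ${\rm ETR}$ implies the class well-order comparability principle: given any two class well-orders, one of them is isomorphic to an initial segment of the other. Moreover, the comparability principle already follows (over ${\rm GBC}^-$) from the assertion that every well-founded class relation has a continuous ranking to some class well-order.
   Context: ${\rm GBC}^-$ is Gödel–Bernays set theory without the power set axiom and with global choice in the form of a class bijection between $V$ and $\mathrm{Ord}$. ${\rm ETR}$ asserts: for every class well-order $\langle\Gamma,\leq_\Gamma\rangle$, every first-order formula $\varphi$ and every class parameter $Z$, there is a class $S\subseteq\Gamma\times V$ with $S_\gamma=\{x\mid\varphi(x,S\restriction\gamma,Z)\}$ for all $\gamma\in\Gamma$, where $S_\gamma=\{x\mid(\gamma,x)\in S\}$ and $S\restriction\gamma=\{(\alpha,x)\in S\mid\alpha<_\Gamma\gamma\}$. A class relation is well-founded if every nonempty subset of its field has a minimal element; a class well-order is a well-founded class linear order. A ranking of $\vartriangleleft$ on $X$ by $\langle\Gamma,\leq_\Gamma\rangle$ is a map $\pi:X\to\Gamma$ with $a\vartriangleleft b\Rightarrow\pi(a)<_\Gamma\pi(b)$; it is continuous if for every $b\in X$, $\pi(b)$ is the $\leq_\Gamma$-least element strictly above $\pi(a)$ for all $a\vartriangleleft b$. *)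

theory Defs
  imports Main
begin

text \<open>
  First-order formulas of the language of class theory: all quantifiers range over sets,
  class variables occur only free. Set variables and class variables are numbered separately.
\<close>

datatype formula =
    Mem nat nat
  | Eql nat nat
  | InC nat nat  \<comment> \<open>set variable, class variable\<close>
  | Neg formula
  | Conj formula formula
  | All nat formula

text \<open>
  Models of class theory are two-sorted. By class extensionality a class may be identified with
  the set of its members, so a model consists of the sets (the type \<^typ>\<open>'v\<close> with the
  membership relation \<open>E\<close>) and a collection \<open>C\<close> of subsets of the universe.
\<close>

locale class_structure =
  fixes E :: "'v \<Rightarrow> 'v \<Rightarrow> bool" (infix "\<epsilon>" 50)
    and C :: "'v set set"
begin

primrec sat :: "(nat \<Rightarrow> 'v) \<Rightarrow> (nat \<Rightarrow> 'v set) \<Rightarrow> formula \<Rightarrow> bool" where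
  "sat s K (Mem i j) \<longleftrightarrow> s i \<epsilon> s j"
| "sat s K (Eql i j) \<longleftrightarrow> s i = s j"
| "sat s K (InC i k) \<longleftrightarrow> s i \<in> K k"
| "sat s K (Neg \<phi>) \<longleftrightarrow> \<not> sat s K \<phi>"
| "sat s K (Conj \<phi> \<psi>) \<longleftrightarrow> sat s K \<phi> \<and> sat s K \<psi>"
| "sat s K (All i \<phi>) \<longleftrightarrow> (\<forall>x. sat (s(i := x)) K \<phi>)"

definition ext :: "'v \<Rightarrow> 'v set" where
  "ext a = {x. x \<epsilon> a}"

definition upair :: "'v \<Rightarrow> 'v \<Rightarrow> 'v" where
  "upair a b = (THE z. ext z = {a, b})"

definition opair :: "'v \<Rightarrow> 'v \<Rightarrow> 'v" where
  "opair a b = upair (upair a a) (upair a b)"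

text \<open>
  Binary relations and maps on the universe are handled as HOL relations and functions; they
  exist in the model if the collection of their Kuratowski pairs is a class.
\<close>

definition code :: "('v \<times> 'v) set \<Rightarrow> 'v set" where
  "code R = (\<lambda>(a, b). opair a b) ` R"

definition class_rel :: "('v \<times> 'v) set \<Rightarrow> bool" where
  "class_rel R \<longleftrightarrow> code R \<in> C"

definition class_map_on :: "'v set \<Rightarrow> ('v \<Rightarrow> 'v) \<Rightarrow> bool" where
  "class_map_on X f \<longleftrightarrow> X \<in> C \<and> class_rel {(x, f x) | x. x \<in> X}"

text \<open>Only nonempty sets, rather than arbitrary nonempty classes, are required to have
  minimal elements.\<close>

definition wf_class_on :: "'v set \<Rightarrow> ('v \<times> 'v) set \<Rightarrow> bool" where
  "wf_class_on X R \<longleftrightarrow>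
     (\<forall>a. ext a \<noteq> {} \<and> ext a \<subseteq> X \<longrightarrow> (\<exists>m \<in> ext a. \<forall>b \<in> ext a. (b, m) \<notin> R))"

definition wf_class_rel :: "('v \<times> 'v) set \<Rightarrow> bool" where
  "wf_class_rel R \<longleftrightarrow> class_rel R \<and> wf_class_on (Field R) R"

text \<open>Class well-orders are given by the reflexive order; the strict part is
  \<open>L - Id\<close>.\<close>

definition class_wellorder :: "'v set \<Rightarrow> ('v \<times> 'v) set \<Rightarrow> bool" where
  "class_wellorder \<Gamma> L \<longleftrightarrow>
     \<Gamma> \<in> C \<and> class_rel L \<and> linear_order_on \<Gamma> L \<and> wf_class_on \<Gamma> (L - Id)"

definition ordinal :: "'v \<Rightarrow> bool" where
  "ordinal a \<longleftrightarrow>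
     (\<forall>x. x \<epsilon> a \<longrightarrow> ext x \<subseteq> ext a) \<and>
     strict_linear_order_on (ext a) {(x, y). x \<epsilon> a \<and> y \<epsilon> a \<and> x \<epsilon> y} \<and>
     wf_class_on (ext a) {(x, y). x \<epsilon> y}"

definition initial_segment :: "'v set \<Rightarrow> 'v set \<Rightarrow> ('v \<times> 'v) set \<Rightarrow> bool" where
  "initial_segment I \<Gamma> L \<longleftrightarrow> I \<in> C \<and> I \<subseteq> \<Gamma> \<and> (\<forall>b \<in> I. \<forall>a \<in> \<Gamma>. (a, b) \<in> L \<longrightarrow> a \<in> I)"

definition class_iso ::
  "'v set \<Rightarrow> ('v \<times> 'v) set \<Rightarrow> 'v set \<Rightarrow> ('v \<times> 'v) set \<Rightarrow> bool" where
  "class_iso \<Gamma> L \<Delta> M \<longleftrightarrow>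
     (\<exists>f. class_map_on \<Gamma> f \<and> bij_betw f \<Gamma> \<Delta> \<and>
          (\<forall>a \<in> \<Gamma>. \<forall>b \<in> \<Gamma>. (a, b) \<in> L \<longleftrightarrow> (f a, f b) \<in> M))"

definition iso_to_initial_segment ::
  "'v set \<Rightarrow> ('v \<times> 'v) set \<Rightarrow> 'v set \<Rightarrow> ('v \<times> 'v) set \<Rightarrow> bool" where
  "iso_to_initial_segment \<Gamma> L \<Delta> M \<longleftrightarrow>
     (\<exists>I. initial_segment I \<Delta> M \<and> class_iso \<Gamma> L I (Restr M I))"

definition wo_comparability :: bool where
  "wo_comparability \<longleftrightarrow>
     (\<forall>\<Gamma> L \<Delta> M. class_wellorder \<Gamma> L \<and> class_wellorder \<Delta> M \<longrightarrow>
        iso_to_initial_segment \<Gamma> L \<Delta> M \<or> iso_to_initial_segment \<Delta> M \<Gamma> L)"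

definition below :: "('v \<times> 'v) set \<Rightarrow> ('v \<times> 'v) set \<Rightarrow> 'v \<Rightarrow> ('v \<times> 'v) set" where
  "below S L \<gamma> = {(\<alpha>, x). (\<alpha>, x) \<in> S \<and> (\<alpha>, \<gamma>) \<in> L - Id}"

text \<open>
  In \<open>\<phi>(x, S\<restriction>\<gamma>, Z)\<close> the set variable is \<open>x\<close>, class variable \<open>0\<close> is
  \<open>S\<restriction>\<gamma>\<close> and class variable \<open>1\<close> is \<open>Z\<close>. The constant valuation of the set variables,
  and reading all further class variables as \<open>Z\<close>, leaves no room for additional parameters,
  so no condition on the free variables of \<open>\<phi>\<close> is needed.
\<close>

definition ETR :: bool where
  "ETR \<longleftrightarrow>
     (\<forall>\<Gamma> L \<phi>. \<forall>Z \<in> C. class_wellorder \<Gamma> L \<longrightarrow>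
        (\<exists>S. class_rel S \<and> S \<subseteq> \<Gamma> \<times> UNIV \<and>
             (\<forall>\<gamma> \<in> \<Gamma>. S `` {\<gamma>} =
                {x. sat (\<lambda>_. x) (\<lambda>k. if k = 0 then code (below S L \<gamma>) else Z) \<phi>})))"

definition ranking ::
  "'v set \<Rightarrow> ('v \<times> 'v) set \<Rightarrow> 'v set \<Rightarrow> ('v \<times> 'v) set \<Rightarrow> ('v \<Rightarrow> 'v) \<Rightarrow> bool" where
  "ranking X R \<Gamma> L \<pi> \<longleftrightarrow>
     class_map_on X \<pi> \<and> \<pi> ` X \<subseteq> \<Gamma> \<and>
     (\<forall>a \<in> X. \<forall>b \<in> X. (a, b) \<in> R \<longrightarrow> (\<pi> a, \<pi> b) \<in> L - Id)"

definition strict_upper_bounds ::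
  "'v set \<Rightarrow> ('v \<times> 'v) set \<Rightarrow> 'v set \<Rightarrow> 'v set" where
  "strict_upper_bounds \<Gamma> L A = {g \<in> \<Gamma>. \<forall>a \<in> A. (a, g) \<in> L - Id}"

definition continuous_ranking ::
  "'v set \<Rightarrow> ('v \<times> 'v) set \<Rightarrow> 'v set \<Rightarrow> ('v \<times> 'v) set \<Rightarrow> ('v \<Rightarrow> 'v) \<Rightarrow> bool" where
  "continuous_ranking X R \<Gamma> L \<pi> \<longleftrightarrow>
     ranking X R \<Gamma> L \<pi> \<and>
     (\<forall>b \<in> X. let U = strict_upper_bounds \<Gamma> L (\<pi> ` {a \<in> X. (a, b) \<in> R})
               in \<pi> b \<in> U \<and> (\<forall>g \<in> U. (\<pi> b, g) \<in> L))"

definition wf_rels_have_continuous_rankings :: bool where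
  "wf_rels_have_continuous_rankings \<longleftrightarrow>
     (\<forall>R. wf_class_rel R \<longrightarrow>
        (\<exists>\<Gamma> L \<pi>. class_wellorder \<Gamma> L \<and> continuous_ranking (Field R) R \<Gamma> L \<pi>))"

end

text \<open>
  Separation and the empty set follow from replacement for partial class functions, and
  collection follows from replacement and global choice. Every set is a class by comprehension.
\<close>

locale GBC_minus = class_structure E C
  for E :: "'v \<Rightarrow> 'v \<Rightarrow> bool" (infix "\<epsilon>" 50) and C :: "'v set set" +
  assumes extensionality: "\<And>a b. ext a = ext b \<Longrightarrow> a = b"
    and pairing: "\<And>a b. \<exists>z. ext z = {a, b}"
    and union: "\<And>a. \<exists>u. ext u = (\<Union>x \<in> ext a. ext x)"
    and infinity: "\<exists>w. (\<exists>z \<in> ext w. ext z = {}) \<and>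
                       (\<forall>x \<in> ext w. \<exists>y \<in> ext w. ext y = insert x (ext x))"
    and foundation: "\<And>a. ext a \<noteq> {} \<Longrightarrow> \<exists>m \<in> ext a. ext m \<inter> ext a = {}"
    and comprehension: "\<And>\<phi> s K. range K \<subseteq> C \<Longrightarrow> {x. sat (s(0 := x)) K \<phi>} \<in> C"
    and replacement: "\<And>F a. class_rel F \<Longrightarrow> single_valued F \<Longrightarrow> \<exists>b. ext b = F `` ext a"
    and global_choice: "\<exists>f. class_map_on UNIV f \<and> bij_betw f UNIV {a. ordinal a}"

end

theory Submission
  imports Defs
begin

text \<open>
  From \<open>ETR\<close>: recursively send \<open>\<gamma> \<in> \<Gamma>\<close> to the least element of \<open>\<Delta>\<close> that is not yet a value,
  until one of the two orders is exhausted. From continuous rankings: rank the disjoint sum of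
  both strict orders, with a bottom element added so that every element lies in the field of the
  relation. The ranking embeds both orders as initial segments of the part of its target above
  the rank of the bottom element, and two such segments are comparable by inclusion. Both
  arguments need least elements of nonempty classes, not just of nonempty sets; these come from
  global choice and a recursion of length \<open>\<omega>\<close>.
\<close>

text \<open>A class well-order need not be set-like: its proper initial segments can be proper
  classes, as in an order longer than \<open>Ord\<close>. So a nonempty class cannot simply be cut
  down below one of its members to a set, and \<open>wf_class_on\<close> does not give its least
  element at once. The global well-order does have set-sized initial segments, which makes a choice
  of predecessors definable. The other obstacle is linguistic: \<open>comprehension\<close> and
  \<open>ETR\<close> speak of concrete formulas, and \<open>ETR\<close> grants one free set variable
  and one class parameter. The predicate \<open>fo \<P>\<close> serves both, with
  \<open>\<P> = C\<close> for the former and \<open>\<P> = {Z}\<close> for the latter, where its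
  class variable stands for the part of the recursion already built. Both implications end in a
  class relation matching elements of the two orders; what they share sits in
  \<open>comparableI\<close>.\<close>

section \<open>First-order definability with class parameters\<close>

primrec rename_classes :: "(nat \<Rightarrow> nat) \<Rightarrow> formula \<Rightarrow> formula" where
  "rename_classes f (Mem i j) = Mem i j"
| "rename_classes f (Eql i j) = Eql i j"
| "rename_classes f (InC i k) = InC i (f k)"
| "rename_classes f (Neg \<phi>) = Neg (rename_classes f \<phi>)"
| "rename_classes f (Conj \<phi> \<psi>) = Conj (rename_classes f \<phi>) (rename_classes f \<psi>)"
| "rename_classes f (All i \<phi>) = All i (rename_classes f \<phi>)"

context class_structure
begin

text \<open>Class variables are never bound, so no capture can occur. Renaming lets two formulas
  with separate parameter lists share one valuation.\<close>

lemma sat_rename_classes: "sat s K (rename_classes f \<phi>) \<longleftrightarrow> sat s (K \<circ> f) \<phi>"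
  by (induction \<phi> arbitrary: s) auto

text \<open>First-order definability with class parameters from \<open>\<P>\<close> and one class variable \<open>X\<close>.
  Set variables are de Bruijn indices into the environment \<open>s\<close>, so closure under quantifiers and
  substitution can be used by resolution, without choosing fresh names.\<close>

inductive fo :: "'v set set \<Rightarrow> ((nat \<Rightarrow> 'v) \<Rightarrow> 'v set \<Rightarrow> bool) \<Rightarrow> bool" for \<P> where
  mem: "fo \<P> (\<lambda>s X. s i \<epsilon> s j)"
| eql: "fo \<P> (\<lambda>s X. s i = s j)"
| var: "fo \<P> (\<lambda>s X. s i \<in> X)"
| par: "A \<in> \<P> \<Longrightarrow> fo \<P> (\<lambda>s X. s i \<in> A)"
| neg: "fo \<P> P \<Longrightarrow> fo \<P> (\<lambda>s X. \<not> P s X)"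
| conj: "fo \<P> P \<Longrightarrow> fo \<P> Q \<Longrightarrow> fo \<P> (\<lambda>s X. P s X \<and> Q s X)"
| all: "fo \<P> P \<Longrightarrow> fo \<P> (\<lambda>s X. \<forall>x. P (case_nat x s) X)"

lemma fo_rename: "fo \<P> P \<Longrightarrow> fo \<P> (\<lambda>s X. P (\<lambda>n. s (r n)) X)"
proof (induction arbitrary: r rule: fo.induct)
  case (all P)
  have "case_nat x (\<lambda>n. s (r n)) = (\<lambda>n. case_nat x s (case_nat 0 (\<lambda>n. Suc (r n)) n))" for x and s :: "nat \<Rightarrow> 'v"
    by (auto split: nat.split)
  then show ?case
    using fo.all[OF all.IH[of "case_nat 0 (\<lambda>n. Suc (r n))"]] by simp
qed (rule fo.intros; assumption)+

text \<open>Link between de Bruijn environments and formulas with named variables. Quantifying over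
  \<open>r\<close> leaves the names open until a binder needs a fresh one; the bound
  \<open>N\<close> guarantees that one exists. Class variable 0 is \<open>X\<close>, and
  \<open>Suc n\<close> is the parameter \<open>K n\<close>.\<close>

definition expressed_by :: "nat \<Rightarrow> (nat \<Rightarrow> 'v set) \<Rightarrow> ((nat \<Rightarrow> 'v) \<Rightarrow> 'v set \<Rightarrow> bool) \<Rightarrow> bool" where
  "expressed_by N K P \<longleftrightarrow>
     (\<forall>s s' X. (\<forall>i<N. s i = s' i) \<longrightarrow> P s X = P s' X) \<and>
     (\<forall>r. \<exists>\<phi>. \<forall>s X. sat s (case_nat X K) \<phi> \<longleftrightarrow> P (\<lambda>n. s (r n)) X)"

lemma expressed_byI:
  assumes "\<And>s s' X. (\<And>i. i < N \<Longrightarrow> s i = s' i) \<Longrightarrow> P s X = P s' X"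
    and "\<And>r. \<exists>\<phi>. \<forall>s X. sat s (case_nat X K) \<phi> \<longleftrightarrow> P (\<lambda>n. s (r n)) X"
  shows "expressed_by N K P"
  unfolding expressed_by_def by (intro conjI allI impI assms) simp

lemma expressed_by_cong:
  assumes "expressed_by N K P" and "\<And>i. i < N \<Longrightarrow> s i = s' i"
  shows "P s X = P s' X"
  using assms(1)[unfolded expressed_by_def, THEN conjunct1, rule_format] assms(2) .

lemma expressed_by_formula:
  "expressed_by N K P \<Longrightarrow> \<exists>\<phi>. \<forall>s X. sat s (case_nat X K) \<phi> \<longleftrightarrow> P (\<lambda>n. s (r n)) X"
  unfolding expressed_by_def by (erule conjE) (erule spec)

lemma expressed_by_neg:
  assumes "expressed_by N K P"
  shows "expressed_by N K (\<lambda>s X. \<not> P s X)"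
proof (rule expressed_byI)
  fix s s' :: "nat \<Rightarrow> 'v" and X
  assume "\<And>i. i < N \<Longrightarrow> s i = s' i"
  then show "(\<not> P s X) = (\<not> P s' X)" using expressed_by_cong[OF assms, of s s' X] by simp
next
  fix r :: "nat \<Rightarrow> nat"
  obtain \<phi> where "\<forall>s X. sat s (case_nat X K) \<phi> \<longleftrightarrow> P (\<lambda>n. s (r n)) X"
    using expressed_by_formula[OF assms, where r = r] by (rule exE)
  then show "\<exists>\<phi>. \<forall>s X. sat s (case_nat X K) \<phi> \<longleftrightarrow> \<not> P (\<lambda>n. s (r n)) X"
    by (intro exI[of _ "Neg \<phi>"]) simp
qed

lemma expressed_by_conj:
  assumes P: "expressed_by N K P" and Q: "expressed_by N' K' Q"
  shows "expressed_by (max N N') (\<lambda>n. if even n then K (n div 2) else K' (n div 2))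
           (\<lambda>s X. P s X \<and> Q s X)" (is "expressed_by _ ?J _")
proof (rule expressed_byI)
  fix s s' :: "nat \<Rightarrow> 'v" and X
  assume "\<And>i. i < max N N' \<Longrightarrow> s i = s' i"
  then show "(P s X \<and> Q s X) = (P s' X \<and> Q s' X)"
    using expressed_by_cong[OF P, of s s' X] expressed_by_cong[OF Q, of s s' X] by simp
next
  fix r :: "nat \<Rightarrow> nat"
  \<comment> \<open>\<open>K\<close> occupies the even places of the merged list and
    \<open>K'\<close> the odd ones; the extra \<open>Suc\<close> skips class variable 0, which both
    formulas share.\<close>
  define f where "f = case_nat 0 (\<lambda>n. Suc (2 * n))"
  define f' where "f' = case_nat 0 (\<lambda>n. Suc (Suc (2 * n)))"
  have f: "case_nat X ?J \<circ> f = case_nat X K" "case_nat X ?J \<circ> f' = case_nat X K'" for X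
    by (auto simp: f_def f'_def fun_eq_iff split: nat.split)
  obtain \<phi> where \<phi>: "\<forall>s X. sat s (case_nat X K) \<phi> \<longleftrightarrow> P (\<lambda>n. s (r n)) X"
    using expressed_by_formula[OF P, where r = r] by (rule exE)
  obtain \<psi> where \<psi>: "\<forall>s X. sat s (case_nat X K') \<psi> \<longleftrightarrow> Q (\<lambda>n. s (r n)) X"
    using expressed_by_formula[OF Q, where r = r] by (rule exE)
  show "\<exists>\<phi>. \<forall>s X. sat s (case_nat X ?J) \<phi> \<longleftrightarrow> P (\<lambda>n. s (r n)) X \<and> Q (\<lambda>n. s (r n)) X"
    by (rule exI[of _ "Conj (rename_classes f \<phi>) (rename_classes f' \<psi>)"])
      (simp only: sat.simps sat_rename_classes f \<phi>[rule_format] \<psi>[rule_format] simp_thms)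
qed

lemma expressed_by_all:
  assumes P: "expressed_by N K P"
  shows "expressed_by N K (\<lambda>s X. \<forall>x. P (case_nat x s) X)"
proof (rule expressed_byI)
  fix s s' :: "nat \<Rightarrow> 'v" and X
  assume *: "\<And>i. i < N \<Longrightarrow> s i = s' i"
  have "P (case_nat x s) X = P (case_nat x s') X" for x
    by (rule expressed_by_cong[OF P]) (simp add: * split: nat.split)
  then show "(\<forall>x. P (case_nat x s) X) = (\<forall>x. P (case_nat x s') X)" by simp
next
  fix r :: "nat \<Rightarrow> nat"
  \<comment> \<open>\<open>m\<close> names the bound variable. It must avoid only the names of the
    first \<open>N\<close> indices; overwriting any other name is invisible to
    \<open>P\<close>.\<close>
  obtain m where m: "m \<notin> r ` {..<N}"
    using ex_new_if_finite[OF infinite_UNIV_nat, of "r ` {..<N}"] by auto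
  obtain \<phi> where \<phi>: "\<forall>s X. sat s (case_nat X K) \<phi> \<longleftrightarrow> P (\<lambda>n. s (case_nat m r n)) X"
    using expressed_by_formula[OF P, where r = "case_nat m r"] by (rule exE)
  have "P (\<lambda>n. (s(m := x)) (case_nat m r n)) X = P (case_nat x (\<lambda>n. s (r n))) X" for s x X
  proof (rule expressed_by_cong[OF P])
    fix i assume "i < N"
    with m have "r j \<noteq> m" if "i = Suc j" for j using that by auto
    then show "(s(m := x)) (case_nat m r i) = case_nat x (\<lambda>n. s (r n)) i"
      by (cases i) auto
  qed
  then show "\<exists>\<phi>. \<forall>s X. sat s (case_nat X K) \<phi> \<longleftrightarrow> (\<forall>x. P (case_nat x (\<lambda>n. s (r n))) X)"
    by (intro exI[of _ "All m \<phi>"]) (simp only: sat.simps \<phi>[rule_format] simp_thms)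
qed

text \<open>\<open>K\<close> is a total sequence, so even a formula without parameters needs a
  filler class; hence \<open>\<P>\<close> must be nonempty.\<close>

lemma fo_expressed_by:
  assumes "fo \<P> P" and "\<P> \<noteq> {}"
  shows "\<exists>N K. range K \<subseteq> \<P> \<and> expressed_by N K P"
  using assms(1)
proof (induction rule: fo.induct)
  case (mem i j)
  obtain A where A: "A \<in> \<P>" using assms(2) by auto
  have "expressed_by (Suc (max i j)) (\<lambda>_. A) (\<lambda>s X. s i \<epsilon> s j)"
  proof (rule expressed_byI)
    show "\<exists>\<phi>. \<forall>s X. sat s (case_nat X (\<lambda>_. A)) \<phi> \<longleftrightarrow> s (r i) \<epsilon> s (r j)" for r
      by (rule exI[of _ "Mem (r i) (r j)"]) simp
  qed simp
  with A show ?case by (intro exI conjI) auto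
next
  case (eql i j)
  obtain A where A: "A \<in> \<P>" using assms(2) by auto
  have "expressed_by (Suc (max i j)) (\<lambda>_. A) (\<lambda>s X. s i = s j)"
  proof (rule expressed_byI)
    show "\<exists>\<phi>. \<forall>s X. sat s (case_nat X (\<lambda>_. A)) \<phi> \<longleftrightarrow> s (r i) = s (r j)" for r
      by (rule exI[of _ "Eql (r i) (r j)"]) simp
  qed simp
  with A show ?case by (intro exI conjI) auto
next
  case (var i)
  obtain A where A: "A \<in> \<P>" using assms(2) by auto
  have "expressed_by (Suc i) (\<lambda>_. A) (\<lambda>s X. s i \<in> X)"
  proof (rule expressed_byI)
    show "\<exists>\<phi>. \<forall>s X. sat s (case_nat X (\<lambda>_. A)) \<phi> \<longleftrightarrow> s (r i) \<in> X" for r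
      by (rule exI[of _ "InC (r i) 0"]) simp
  qed simp
  with A show ?case by (intro exI conjI) auto
next
  case (par A i)
  have "expressed_by (Suc i) (\<lambda>_. A) (\<lambda>s X. s i \<in> A)"
  proof (rule expressed_byI)
    show "\<exists>\<phi>. \<forall>s X. sat s (case_nat X (\<lambda>_. A)) \<phi> \<longleftrightarrow> s (r i) \<in> A" for r
      by (rule exI[of _ "InC (r i) 1"]) simp
  qed simp
  with par show ?case by (intro exI conjI) auto
next
  case (neg P)
  then obtain N K where "range K \<subseteq> \<P>" "expressed_by N K P" by (elim exE conjE)
  then show ?case by (intro exI conjI expressed_by_neg)
next
  case (conj P Q)
  obtain N K where P: "range K \<subseteq> \<P>" "expressed_by N K P" using conj.IH(1) by (elim exE conjE)
  obtain N' K' where Q: "range K' \<subseteq> \<P>" "expressed_by N' K' Q" using conj.IH(2) by (elim exE conjE)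
  have "range (\<lambda>n. if even n then K (n div 2) else K' (n div 2)) \<subseteq> \<P>" using P(1) Q(1) by auto
  with expressed_by_conj[OF P(2) Q(2)] show ?case by (intro exI conjI)
next
  case (all P)
  then obtain N K where "range K \<subseteq> \<P>" "expressed_by N K P" by (elim exE conjE)
  then show ?case by (intro exI conjI expressed_by_all)
qed

text \<open>A term is definable through its graph, with the value at index 0. Substitution then
  reduces to an existential quantifier.\<close>

definition fo_term :: "'v set set \<Rightarrow> ((nat \<Rightarrow> 'v) \<Rightarrow> 'v) \<Rightarrow> bool" where
  "fo_term \<P> t \<longleftrightarrow> fo \<P> (\<lambda>s X. s 0 = t (\<lambda>n. s (Suc n)))"

named_theorems fo_intros

lemma fo_not [fo_intros]: "fo \<P> P \<Longrightarrow> fo \<P> (\<lambda>s X. \<not> P s X)"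
  by (rule fo.neg)

lemma fo_conj [fo_intros]: "fo \<P> P \<Longrightarrow> fo \<P> Q \<Longrightarrow> fo \<P> (\<lambda>s X. P s X \<and> Q s X)"
  by (rule fo.conj)

lemma fo_disj [fo_intros]: "fo \<P> P \<Longrightarrow> fo \<P> Q \<Longrightarrow> fo \<P> (\<lambda>s X. P s X \<or> Q s X)"
  using fo_not[OF fo_conj[OF fo_not fo_not], of \<P> P Q] by simp

lemma fo_imp [fo_intros]: "fo \<P> P \<Longrightarrow> fo \<P> Q \<Longrightarrow> fo \<P> (\<lambda>s X. P s X \<longrightarrow> Q s X)"
  unfolding imp_conv_disj by (intro fo_disj fo_not)

lemma fo_iff [fo_intros]: "fo \<P> P \<Longrightarrow> fo \<P> Q \<Longrightarrow> fo \<P> (\<lambda>s X. P s X \<longleftrightarrow> Q s X)"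
  unfolding iff_conv_conj_imp by (intro fo_conj fo_imp)

lemma fo_all [fo_intros]:
  assumes "fo \<P> (\<lambda>s X. P (s 0) (\<lambda>n. s (Suc n)) X)"
  shows "fo \<P> (\<lambda>s X. \<forall>x. P x s X)"
  using fo.all[OF assms] by simp

lemma fo_ex [fo_intros]:
  assumes "fo \<P> (\<lambda>s X. P (s 0) (\<lambda>n. s (Suc n)) X)"
  shows "fo \<P> (\<lambda>s X. \<exists>x. P x s X)"
  using fo_not[OF fo_all[OF fo_not[OF assms]]] by simp

lemma fo_subst:
  assumes "fo_term \<P> t" and "fo \<P> (\<lambda>s X. P (s 0) (\<lambda>n. s (Suc n)) X)"
  shows "fo \<P> (\<lambda>s X. P (t s) s X)"
  using fo_ex[OF fo_conj[OF assms(1)[unfolded fo_term_def] assms(2)]] by simp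

lemma fo_term_weaken: "fo_term \<P> t \<Longrightarrow> fo_term \<P> (\<lambda>s. t (\<lambda>n. s (r n)))"
  unfolding fo_term_def
  by (drule fo_rename[where r = "case_nat 0 (\<lambda>n. Suc (r n))"]) simp

lemma fo_term_var [fo_intros]: "fo_term \<P> (\<lambda>s. s i)"
  unfolding fo_term_def by (rule fo.eql)

lemma fo_subst2:
  assumes "fo_term \<P> t" and "fo_term \<P> u"
    and "fo \<P> (\<lambda>s X. P (s 1) (s 0) (\<lambda>n. s (Suc (Suc n))) X)"
  shows "fo \<P> (\<lambda>s X. P (t s) (u s) s X)"
  by (rule fo_subst[OF assms(1)],
      rule fo_subst[OF fo_term_weaken[OF assms(2), of Suc], of "\<lambda>y s X. P (s 0) y (\<lambda>n. s (Suc n)) X"])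
    (use assms(3) in simp)

lemma fo_eq [fo_intros]: "fo_term \<P> t \<Longrightarrow> fo_term \<P> u \<Longrightarrow> fo \<P> (\<lambda>s X. t s = u s)"
  by (rule fo_subst2) (auto intro: fo.eql)

lemma fo_mem [fo_intros]: "fo_term \<P> t \<Longrightarrow> fo_term \<P> u \<Longrightarrow> fo \<P> (\<lambda>s X. t s \<epsilon> u s)"
  by (rule fo_subst2) (auto intro: fo.mem)

lemma fo_in_class [fo_intros]: "A \<in> \<P> \<Longrightarrow> fo_term \<P> t \<Longrightarrow> fo \<P> (\<lambda>s X. t s \<in> A)"
  by (rule fo_subst[where P = "\<lambda>x s X. x \<in> A"]) (simp_all only: fo.par)

lemma fo_in_var [fo_intros]: "fo_term \<P> t \<Longrightarrow> fo \<P> (\<lambda>s X. t s \<in> X)"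
  by (rule fo_subst[where P = "\<lambda>x s X. x \<in> X"]) (simp_all only: fo.var)

end

section \<open>Pairs and definable classes\<close>

context GBC_minus
begin

lemma ext_iff: "x \<in> ext a \<longleftrightarrow> x \<epsilon> a"
  by (simp add: ext_def)

lemma set_eqI: "(\<And>x. x \<epsilon> a \<longleftrightarrow> x \<epsilon> b) \<Longrightarrow> a = b"
  by (rule extensionality) (simp add: ext_def)

lemma mem_upair: "x \<epsilon> upair a b \<longleftrightarrow> x = a \<or> x = b"
proof -
  obtain z where z: "ext z = {a, b}" using pairing by blast
  have "upair a b = z" unfolding upair_def
    using z by (intro the_equality) (auto intro: extensionality)
  with z show ?thesis by (metis ext_iff insert_iff singletonD singletonI)
qed

lemma eq_upair_iff: "z = upair a b \<longleftrightarrow> (\<forall>x. x \<epsilon> z \<longleftrightarrow> x = a \<or> x = b)"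
  using mem_upair set_eqI by metis

lemma upair_eq_iff: "upair a b = upair c d \<longleftrightarrow> a = c \<and> b = d \<or> a = d \<and> b = c"
proof -
  have "upair a b = upair c d \<longleftrightarrow> {a, b} = {c, d}"
    unfolding eq_upair_iff[of "upair a b"] mem_upair by (simp add: set_eq_iff)
  then show ?thesis by (simp add: doubleton_eq_iff)
qed

lemma opair_eq_iff [simp]: "opair a b = opair c d \<longleftrightarrow> a = c \<and> b = d"
  unfolding opair_def upair_eq_iff by auto

lemma opair_in_code [simp]: "opair a b \<in> code R \<longleftrightarrow> (a, b) \<in> R"
  by (auto simp: code_def)

lemma UNIV_class: "UNIV \<in> C"
  using global_choice by (auto simp: class_map_on_def)

lemma class_of_fo:
  assumes "fo C (\<lambda>s X. P (s 0))"
  shows "{x. P x} \<in> C"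
proof -
  have C: "C \<noteq> {}" using UNIV_class by auto
  obtain N K where K: "range K \<subseteq> C" "expressed_by N K (\<lambda>s X. P (s 0))"
    using fo_expressed_by[OF assms C] by (elim exE conjE)
  obtain \<phi> where \<phi>: "\<forall>s X. sat s (case_nat X K) \<phi> \<longleftrightarrow> P (s 0)"
    using expressed_by_formula[OF K(2), where r = "\<lambda>n. n"] by (rule exE)
  have "range (case_nat UNIV K) \<subseteq> C"
    using K(1) UNIV_class by (auto simp: subset_iff split: nat.split)
  from comprehension[OF this, of "\<lambda>_. undefined" \<phi>] show ?thesis
    by (simp add: \<phi>)
qed

text \<open>\<open>fo\<close> has no set constants: a set \<open>c\<close> enters as the class
  parameter \<open>{c}\<close>. The valuation gives set variable 1 the value
  \<open>c\<close>.\<close>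

lemma singleton_class: "{c} \<in> C"
  using comprehension[of "\<lambda>_. UNIV" "\<lambda>_. c" "Eql 0 1"] UNIV_class by simp

lemma fo_term_const [fo_intros]: "fo_term C (\<lambda>s. c)"
  unfolding fo_term_def using fo_in_class[OF singleton_class fo_term_var[of C 0], of c] by simp

lemma fo_term_upair: "fo_term \<P> t \<Longrightarrow> fo_term \<P> u \<Longrightarrow> fo_term \<P> (\<lambda>s. upair (t s) (u s))"
  unfolding fo_term_def[of \<P> "\<lambda>s. upair (t s) (u s)"] eq_upair_iff
  by (intro fo_intros) (erule fo_term_weaken)+

lemma fo_term_opair [fo_intros]:
  "fo_term \<P> t \<Longrightarrow> fo_term \<P> u \<Longrightarrow> fo_term \<P> (\<lambda>s. opair (t s) (u s))"
  unfolding opair_def by (intro fo_term_upair)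

lemma fo_rel [fo_intros]:
  "class_rel R \<Longrightarrow> fo_term C t \<Longrightarrow> fo_term C u \<Longrightarrow> fo C (\<lambda>s X. (t s, u s) \<in> R)"
  unfolding opair_in_code[symmetric] class_rel_def by (intro fo_intros)

lemma class_rel_of_fo:
  assumes "fo C (\<lambda>s X. P (s 0) (s 1))"
  shows "class_rel {(x, y). P x y}"
proof -
  \<comment> \<open>Below the quantifiers over \<open>x\<close> and then \<open>y\<close>, the inner
    \<open>y\<close> has index 0, so indices 0 and 1 are swapped.\<close>
  have P: "fo C (\<lambda>s X. P (s (Suc 0)) (s 0))"
    using fo_rename[OF assms, of "\<lambda>n. 1 - n"] by simp
  have "{z. \<exists>x y. z = opair x y \<and> P x y} \<in> C"
    by (rule class_of_fo) (intro fo_intros P)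
  moreover have "code {(x, y). P x y} = {z. \<exists>x y. z = opair x y \<and> P x y}"
    by (auto simp: code_def)
  ultimately show ?thesis by (simp add: class_rel_def)
qed

lemma fo_ext_eq_insert: "fo C (\<lambda>s X. ext (s i) = insert (s j) (ext (s j)))"
  unfolding set_eq_iff insert_iff ext_iff by (intro fo_intros)

lemma separation: "A \<in> C \<Longrightarrow> \<exists>b. \<forall>x. x \<epsilon> b \<longleftrightarrow> x \<epsilon> a \<and> x \<in> A"
proof -
  assume "A \<in> C"
  then have "class_rel {(x, y). x \<in> A \<and> x = y}"
    by (intro class_rel_of_fo fo_intros)
  moreover have "single_valued {(x, y). x \<in> A \<and> x = y}" by (auto simp: single_valued_def)
  ultimately obtain b where "ext b = {(x, y). x \<in> A \<and> x = y} `` ext a"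
    using replacement by blast
  then show ?thesis by (intro exI[of _ b]) (auto simp: ext_def)
qed

lemma replacement_mem:
  assumes "class_rel F" "single_valued F"
  shows "\<exists>b. \<forall>y. y \<epsilon> b \<longleftrightarrow> (\<exists>x. x \<epsilon> a \<and> (x, y) \<in> F)"
proof -
  obtain b where "ext b = F `` ext a" using replacement[OF assms] by blast
  then show ?thesis by (intro exI[of _ b]) (auto simp: ext_def)
qed

section \<open>Foundation and iteration of class functions\<close>

lemma foundation_mem: "x \<epsilon> a \<Longrightarrow> \<exists>m. m \<epsilon> a \<and> (\<forall>y. y \<epsilon> a \<longrightarrow> \<not> y \<epsilon> m)"
  using foundation[of a] by (auto simp: ext_def)

lemma not_mem_self: "\<not> x \<epsilon> x"
  using foundation_mem[of x "upair x x"] by (auto simp: mem_upair)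

lemma not_mem_sym: "x \<epsilon> y \<Longrightarrow> \<not> y \<epsilon> x"
  using foundation_mem[of x "upair x y"] by (auto simp: mem_upair)

lemma adjoin_exists: "\<exists>b. \<forall>x. x \<epsilon> b \<longleftrightarrow> x \<epsilon> a \<or> x = c"
proof -
  obtain u where u: "ext u = (\<Union>x \<in> ext (upair a (upair c c)). ext x)" using union by blast
  have "x \<epsilon> u \<longleftrightarrow> x \<epsilon> a \<or> x = c" for x
    using u[unfolded set_eq_iff, rule_format, of x] by (auto simp: ext_def mem_upair)
  then show ?thesis by blast
qed

text \<open>\<open>(n, y) \<in> H\<close> says that \<open>y\<close> is the \<open>n\<close>-th iterate of \<open>x0\<close> under \<open>G\<close>, as witnessed by a set
  \<open>p\<close> of derivation steps. Replacement only needs \<open>H\<close> to be single-valued, so \<open>\<omega>\<close> itself is not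
  required: any inductive set \<open>w\<close> serves as the index set.\<close>

lemma closed_set:
  assumes G: "class_rel G" "single_valued G"
  shows "\<exists>a. x0 \<epsilon> a \<and> (\<forall>x y. x \<epsilon> a \<longrightarrow> (x, y) \<in> G \<longrightarrow> y \<epsilon> a)"
proof -
  obtain w e where w: "e \<epsilon> w" "ext e = {}"
    "\<And>x. x \<epsilon> w \<Longrightarrow> \<exists>y. y \<epsilon> w \<and> ext y = insert x (ext x)"
    using infinity unfolding Bex_def Ball_def ext_iff by blast
  define suc where "suc = {(x, y). ext y = insert x (ext x)}"
  have suc: "class_rel suc"
    unfolding suc_def by (intro class_rel_of_fo fo_ext_eq_insert)
  \<comment> \<open>Two distinct predecessors of one set would be members of each other.\<close>
  have suc_inj: "j = j'" if "(j, k) \<in> suc" "(j', k) \<in> suc" for j j' k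
  proof (rule ccontr)
    assume "j \<noteq> j'"
    then have "j \<epsilon> j'" "j' \<epsilon> j"
      using that unfolding suc_def by (auto simp: set_eq_iff ext_iff)
    then show False using not_mem_sym by blast
  qed
  have suc_mem: "j \<epsilon> k" if "(j, k) \<in> suc" for j k
    using that unfolding suc_def by (auto simp: set_eq_iff ext_iff)
  then have suc_e: "(j, e) \<notin> suc" for j
    using w(2) by (auto simp: ext_def)
  \<comment> \<open>Functionality is not demanded of \<open>p\<close>; it comes out of the
    uniqueness proof below.\<close>
  define der where "der p \<longleftrightarrow> (\<forall>q. q \<epsilon> p \<longrightarrow> q = opair e x0 \<or>
      (\<exists>j k y y'. (j, k) \<in> suc \<and> opair j y \<epsilon> p \<and> (y, y') \<in> G \<and> q = opair k y'))" for p
  define H where "H = {(n, y). \<exists>p. opair n y \<epsilon> p \<and> der p}"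
  have H: "class_rel H"
    unfolding H_def der_def by (intro class_rel_of_fo fo_intros suc G)
  have der_cases: "(k = e \<and> y = x0) \<or> (\<exists>j z. (j, k) \<in> suc \<and> opair j z \<epsilon> p \<and> (z, y) \<in> G)"
    if "der p" "opair k y \<epsilon> p" for p k y
    using that unfolding der_def by (metis opair_eq_iff)
  have "single_valued H"
  proof (rule single_valuedI, rule ccontr)
    fix n y y'
    assume n: "(n, y) \<in> H" "(n, y') \<in> H" "y \<noteq> y'"
    then obtain p where p: "opair n y \<epsilon> p" "der p" unfolding H_def by blast
    \<comment> \<open>A least conflicting index is wanted, but conflicting indices form only a
      class. \<open>F\<close> sends pairs of \<open>p\<close> to their conflicting indices, so
      replacement collects those met in \<open>p\<close> in a set. Derivations in \<open>p\<close>
      go back to pairs of \<open>p\<close>, so its minimum suffices.\<close>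
    define F where "F = {(q, k). \<exists>z z'. q = opair k z \<and> (k, z') \<in> H \<and> z \<noteq> z'}"
    have "class_rel F" unfolding F_def by (intro class_rel_of_fo fo_intros H)
    moreover have "single_valued F" unfolding F_def single_valued_def by auto
    ultimately obtain b where b: "\<And>k. k \<epsilon> b \<longleftrightarrow> (\<exists>q. q \<epsilon> p \<and> (q, k) \<in> F)"
      using replacement_mem[of F p] by blast
    then have b: "k \<epsilon> b \<longleftrightarrow> (\<exists>z z'. opair k z \<epsilon> p \<and> (k, z') \<in> H \<and> z \<noteq> z')" for k
      unfolding F_def by auto
    have "n \<epsilon> b" using b n p by blast
    then obtain k where k: "k \<epsilon> b" "\<And>j. j \<epsilon> b \<Longrightarrow> \<not> j \<epsilon> k" using foundation_mem by blast
    then obtain z z' p' where z: "opair k z \<epsilon> p" "opair k z' \<epsilon> p'" "der p'" "z \<noteq> z'"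
      using b unfolding H_def by blast
    show False
    proof (cases "k = e")
      case True
      with der_cases[OF p(2) z(1)] der_cases[OF z(3,2)] suc_e z(4) show False by blast
    next
      case False
      with der_cases[OF p(2) z(1)] der_cases[OF z(3,2)]
      obtain j u j' u' where j: "(j, k) \<in> suc" "opair j u \<epsilon> p" "(u, z) \<in> G"
        "(j', k) \<in> suc" "opair j' u' \<epsilon> p'" "(u', z') \<in> G" by blast
      then have [simp]: "j' = j" using suc_inj by blast
      have "u \<noteq> u'" using j G(2) z(4) unfolding single_valued_def by blast
      moreover have "(j, u') \<in> H" using j z(3) unfolding H_def by auto
      ultimately have "j \<epsilon> b" using b j by blast
      with k(2) suc_mem j(1) show False by blast
    qed
  qed
  \<comment> \<open>\<open>a\<close> collects the iterates whose index lies in \<open>w\<close>;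
    closure of \<open>w\<close> under successor gives closure of \<open>a\<close> under
    \<open>G\<close>.\<close>
  then obtain a where a: "\<And>y. y \<epsilon> a \<longleftrightarrow> (\<exists>n. n \<epsilon> w \<and> (n, y) \<in> H)"
    using replacement_mem[OF H, of w] by blast
  have "der (upair (opair e x0) (opair e x0))" unfolding der_def by (simp add: mem_upair)
  then have "(e, x0) \<in> H" unfolding H_def
    by (auto simp: mem_upair intro!: exI[of _ "upair (opair e x0) (opair e x0)"])
  then have "x0 \<epsilon> a" using a w(1) by blast
  moreover have "y \<epsilon> a" if xa: "x \<epsilon> a" and xy: "(x, y) \<in> G" for x y
  proof -
    obtain n p where n: "n \<epsilon> w" "opair n x \<epsilon> p" "der p"
      using xa unfolding a[of x] H_def by blast
    obtain k where k: "k \<epsilon> w" "(n, k) \<in> suc" using w(3)[OF n(1)] unfolding suc_def by blast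
    obtain p' where p': "\<And>q. q \<epsilon> p' \<longleftrightarrow> q \<epsilon> p \<or> q = opair k y"
      using adjoin_exists by metis
    have "der p'" unfolding der_def
    proof (intro allI impI)
      fix q assume "q \<epsilon> p'"
      then consider "q \<epsilon> p" | "q = opair k y" using p' by blast
      then show "q = opair e x0 \<or>
        (\<exists>j k y y'. (j, k) \<in> suc \<and> opair j y \<epsilon> p' \<and> (y, y') \<in> G \<and> q = opair k y')"
      proof cases
        case 1
        then show ?thesis using n(3) p' unfolding der_def by metis
      next
        case 2
        then show ?thesis using k(2) n(2) xy p' by blast
      qed
    qed
    then have "(k, y) \<in> H" using p' unfolding H_def by blast
    then show ?thesis using a k(1) by blast
  qed
  ultimately show ?thesis by blast
qed

section \<open>Ordinals, the global well-order and minimal elements of classes\<close>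

lemma ordinal_mem_trans: "ordinal a \<Longrightarrow> x \<epsilon> a \<Longrightarrow> y \<epsilon> x \<Longrightarrow> y \<epsilon> a"
  unfolding ordinal_def by (auto simp: ext_def)

lemma ordinal_mem_total: "ordinal a \<Longrightarrow> x \<epsilon> a \<Longrightarrow> y \<epsilon> a \<Longrightarrow> x \<epsilon> y \<or> x = y \<or> y \<epsilon> x"
  unfolding ordinal_def strict_linear_order_on_def total_on_def by (auto simp: ext_def)

text \<open>A minimal \<open>m\<close> in \<open>a\<close> outside \<open>c\<close> equals
  \<open>c\<close>: its members lie in \<open>c\<close> by minimality, and a member of
  \<open>c\<close> that was \<open>m\<close> or contained \<open>m\<close> would put
  \<open>m\<close> into \<open>c\<close>.\<close>

lemma transitive_subset_of_ordinal:
  assumes a: "ordinal a" and c: "\<And>x. x \<epsilon> c \<Longrightarrow> x \<epsilon> a" "\<And>x y. x \<epsilon> c \<Longrightarrow> y \<epsilon> x \<Longrightarrow> y \<epsilon> c"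
  shows "c = a \<or> c \<epsilon> a"
proof (cases "c = a")
  case False
  then obtain x where x: "x \<epsilon> a" "\<not> x \<epsilon> c" using set_eqI[of c a] c(1) by blast
  have "{x. \<not> x \<epsilon> c} \<in> C" by (intro class_of_fo fo_intros)
  then obtain d where d: "\<And>x. x \<epsilon> d \<longleftrightarrow> x \<epsilon> a \<and> \<not> x \<epsilon> c"
    using separation[of "{x. \<not> x \<epsilon> c}" a] by auto
  then obtain m where m: "m \<epsilon> d" "\<And>y. y \<epsilon> d \<Longrightarrow> \<not> y \<epsilon> m" using foundation_mem x by blast
  have "m = c"
  proof (rule set_eqI)
    fix y
    show "y \<epsilon> m \<longleftrightarrow> y \<epsilon> c"
      using m d ordinal_mem_trans[OF a] ordinal_mem_total[OF a] c by metis
  qed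
  with m(1) d show ?thesis by blast
qed simp

text \<open>The intersection \<open>c\<close> of \<open>a\<close> and \<open>b\<close> is a
  transitive subset of both. If it were a member of both, it would be a member of itself.\<close>

lemma ordinal_linear:
  assumes "ordinal a" "ordinal b"
  shows "a \<epsilon> b \<or> a = b \<or> b \<epsilon> a"
proof -
  have "{x. x \<epsilon> b} \<in> C" by (intro class_of_fo fo_intros)
  then obtain c where c: "\<And>x. x \<epsilon> c \<longleftrightarrow> x \<epsilon> a \<and> x \<epsilon> b"
    using separation[of "{x. x \<epsilon> b}" a] by auto
  have "c = a \<or> c \<epsilon> a"
    by (rule transitive_subset_of_ordinal[OF assms(1)]) (use c assms ordinal_mem_trans in blast)+
  moreover have "c = b \<or> c \<epsilon> b"
    by (rule transitive_subset_of_ordinal[OF assms(2)]) (use c assms ordinal_mem_trans in blast)+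
  ultimately show ?thesis using c[of c] not_mem_self[of c] by blast
qed

text \<open>\<open>W\<close> is membership of ordinals pulled back along the global choice
  bijection. Below a member of \<open>D\<close> it has only a set of elements, so separation and
  foundation reach the whole class \<open>D\<close>.\<close>

lemma global_wellorder:
  obtains W where "class_rel W"
    and "\<And>x y. x = y \<or> (x, y) \<in> W \<or> (y, x) \<in> W"
    and "\<And>D. D \<in> C \<Longrightarrow> D \<noteq> {} \<Longrightarrow> \<exists>y \<in> D. \<forall>x \<in> D. (x, y) \<notin> W"
proof -
  obtain g where g: "class_map_on UNIV g" "bij_betw g UNIV {a. ordinal a}"
    using global_choice by blast
  define gr where "gr = {(x, g x) | x. x \<in> UNIV}"
  have gr: "class_rel gr" using g(1) unfolding class_map_on_def gr_def by simp
  have ord: "ordinal (g x)" for x using g(2) by (auto simp: bij_betw_def)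
  define W where "W = {(x, y). \<exists>u v. (x, u) \<in> gr \<and> (y, v) \<in> gr \<and> u \<epsilon> v}"
  have W_iff: "(x, y) \<in> W \<longleftrightarrow> g x \<epsilon> g y" for x y unfolding W_def gr_def by auto
  have "class_rel W" unfolding W_def by (intro class_rel_of_fo fo_intros gr)
  moreover have "x = y \<or> (x, y) \<in> W \<or> (y, x) \<in> W" for x y
    using ordinal_linear[OF ord ord, of x y] g(2) unfolding W_iff bij_betw_def inj_def by blast
  moreover have "\<exists>y \<in> D. \<forall>x \<in> D. (x, y) \<notin> W" if D: "D \<in> C" "D \<noteq> {}" for D
  proof -
    obtain y0 where y0: "y0 \<in> D" using D(2) by blast
    have "{o'. \<exists>y. y \<in> D \<and> (y, o') \<in> gr} \<in> C" by (intro class_of_fo fo_intros D(1) gr)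
    then obtain b where "\<And>x. x \<epsilon> b \<longleftrightarrow> x \<epsilon> g y0 \<and> x \<in> {o'. \<exists>y. y \<in> D \<and> (y, o') \<in> gr}"
      using separation[of _ "g y0"] by blast
    then have b: "x \<epsilon> b \<longleftrightarrow> x \<epsilon> g y0 \<and> (\<exists>y \<in> D. x = g y)" for x unfolding gr_def by auto
    show ?thesis
    proof (cases "\<exists>x. x \<epsilon> b")
      case True
      then obtain m where m: "m \<epsilon> b" "\<And>y. y \<epsilon> b \<Longrightarrow> \<not> y \<epsilon> m" using foundation_mem by blast
      then obtain y where y: "y \<in> D" "m = g y" "g y \<epsilon> g y0" using b[of m] by auto
      have "(x, y) \<notin> W" if "x \<in> D" for x
        using m(2)[of "g x"] b[of "g x"] that y ordinal_mem_trans[OF ord y(3)] unfolding W_iff by blast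
      with y(1) show ?thesis by blast
    next
      case False
      with b y0 show ?thesis unfolding W_iff by blast
    qed
  qed
  ultimately show ?thesis using that by blast
qed

text \<open>If \<open>A\<close> had no minimal element, a set closed under a class choice of predecessors in
  \<open>A\<close> would contradict well-foundedness for sets.\<close>

lemma wf_class_minimal:
  assumes "wf_class_on X R" "class_rel R" "A \<in> C" "A \<subseteq> X" "x0 \<in> A"
  shows "\<exists>m \<in> A. \<forall>b \<in> A. (b, m) \<notin> R"
proof (rule ccontr)
  assume "\<not> ?thesis"
  then have no_min: "\<exists>b. b \<in> A \<and> (b, m) \<in> R" if "m \<in> A" for m using that by blast
  obtain W where W: "class_rel W" "\<And>x y. x = y \<or> (x, y) \<in> W \<or> (y, x) \<in> W"
    "\<And>D. D \<in> C \<Longrightarrow> D \<noteq> {} \<Longrightarrow> \<exists>y \<in> D. \<forall>x \<in> D. (x, y) \<notin> W"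
    using global_wellorder by blast
  define G where "G = {(x, y). y \<in> A \<and> (y, x) \<in> R \<and> (\<forall>z. z \<in> A \<and> (z, x) \<in> R \<longrightarrow> (z, y) \<notin> W)}"
  have "class_rel G" unfolding G_def by (intro class_rel_of_fo fo_intros assms W)
  moreover have "single_valued G" unfolding G_def single_valued_def using W(2) by blast
  ultimately obtain a where a: "x0 \<epsilon> a" "\<And>x y. x \<epsilon> a \<Longrightarrow> (x, y) \<in> G \<Longrightarrow> y \<epsilon> a"
    using closed_set[of G x0] by blast
  \<comment> \<open>\<open>closed_set\<close> does not bound \<open>a\<close> from above, so its
    part in \<open>A\<close> is taken; it is still closed, since values of \<open>G\<close> lie in
    \<open>A\<close>.\<close>
  obtain a' where a': "\<And>x. x \<epsilon> a' \<longleftrightarrow> x \<epsilon> a \<and> x \<in> A" using separation[OF assms(3)] by blast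
  have "ext a' \<noteq> {}" "ext a' \<subseteq> X" using a' a(1) assms(4,5) by (auto simp: ext_def)
  then obtain m where m: "m \<epsilon> a'" "\<And>b. b \<epsilon> a' \<Longrightarrow> (b, m) \<notin> R"
    using assms(1) unfolding wf_class_on_def by (auto simp: ext_def)
  have "{y. y \<in> A \<and> (y, m) \<in> R} \<in> C" by (intro class_of_fo fo_intros assms)
  moreover have "{y. y \<in> A \<and> (y, m) \<in> R} \<noteq> {}" using no_min m(1) a' by blast
  ultimately obtain y where "(m, y) \<in> G" using W(3) unfolding G_def by blast
  moreover from this have "y \<in> A" "(y, m) \<in> R" unfolding G_def by auto
  ultimately show False using m a a' by blast
qed

section \<open>Class well-orders and partial isomorphisms\<close>

lemma class_wellorderD:
  assumes "class_wellorder \<Gamma> L"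
  shows "\<Gamma> \<in> C" "class_rel L" "L \<subseteq> \<Gamma> \<times> \<Gamma>"
    and "x \<in> \<Gamma> \<Longrightarrow> (x, x) \<in> L"
    and "(x, y) \<in> L \<Longrightarrow> (y, z) \<in> L \<Longrightarrow> (x, z) \<in> L"
    and "(x, y) \<in> L \<Longrightarrow> (y, x) \<in> L \<Longrightarrow> x = y"
    and "x \<in> \<Gamma> \<Longrightarrow> y \<in> \<Gamma> \<Longrightarrow> (x, y) \<in> L \<or> (y, x) \<in> L"
proof -
  have L: "\<Gamma> \<in> C" "class_rel L" "L \<subseteq> \<Gamma> \<times> \<Gamma>" "refl_on \<Gamma> L" "trans L" "antisym L" "total_on \<Gamma> L"
    using assms unfolding class_wellorder_def order_on_defs by simp_all
  show "\<Gamma> \<in> C" "class_rel L" "L \<subseteq> \<Gamma> \<times> \<Gamma>" by (fact L)+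
  show refl: "x \<in> \<Gamma> \<Longrightarrow> (x, x) \<in> L" using L(4) by (rule refl_onD)
  show "(x, y) \<in> L \<Longrightarrow> (y, z) \<in> L \<Longrightarrow> (x, z) \<in> L" using L(5) by (rule transD)
  show "(x, y) \<in> L \<Longrightarrow> (y, x) \<in> L \<Longrightarrow> x = y" using L(6) by (rule antisymD)
  show "x \<in> \<Gamma> \<Longrightarrow> y \<in> \<Gamma> \<Longrightarrow> (x, y) \<in> L \<or> (y, x) \<in> L"
    using L(7) refl by (cases "x = y") (simp_all add: total_on_def)
qed

lemma class_wellorder_least:
  assumes L: "class_wellorder \<Gamma> L" and A: "A \<in> C" "A \<subseteq> \<Gamma>" "x0 \<in> A"
  shows "\<exists>m \<in> A. \<forall>b \<in> A. (m, b) \<in> L"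
proof -
  note L' = class_wellorderD[OF L]
  have "class_rel {(x, y). (x, y) \<in> L \<and> x \<noteq> y}" by (intro class_rel_of_fo fo_intros L')
  moreover have "{(x, y). (x, y) \<in> L \<and> x \<noteq> y} = L - Id" by auto
  ultimately have "class_rel (L - Id)" by simp
  then obtain m where "m \<in> A" "\<And>b. b \<in> A \<Longrightarrow> (b, m) \<notin> L - Id"
    using wf_class_minimal[of \<Gamma> "L - Id" A x0] L A unfolding class_wellorder_def by blast
  then show ?thesis using L'(4,7) A(2) by blast
qed

text \<open>A relation \<open>T\<close> is given instead of a map because definability is a matter
  of graphs. Single-valuedness and injectivity both come from \<open>embed\<close>: equality on one
  side is \<open>\<le>\<close> in both directions, which carries over to the other side.\<close>

lemma iso_to_initial_segmentI:
  assumes L: "class_wellorder \<Gamma> L" and M: "class_wellorder \<Delta> M"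
    and T: "class_rel T" "T \<subseteq> \<Gamma> \<times> \<Delta>" "\<And>a. a \<in> \<Gamma> \<Longrightarrow> \<exists>x. (a, x) \<in> T"
    and embed: "\<And>a x b y. (a, x) \<in> T \<Longrightarrow> (b, y) \<in> T \<Longrightarrow> (a, b) \<in> L \<longleftrightarrow> (x, y) \<in> M"
    and down: "\<And>a x y. (a, x) \<in> T \<Longrightarrow> (y, x) \<in> M \<Longrightarrow> \<exists>b. (b, y) \<in> T"
  shows "iso_to_initial_segment \<Gamma> L \<Delta> M"
proof -
  note L' = class_wellorderD[OF L] and M' = class_wellorderD[OF M]
  have "{x. \<exists>a. (a, x) \<in> T} \<in> C" by (intro class_of_fo fo_intros T)
  moreover have "{x. \<exists>a. (a, x) \<in> T} = Range T" by auto
  ultimately have R: "Range T \<in> C" by simp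
  have init: "initial_segment (Range T) \<Delta> M"
    unfolding initial_segment_def using R T(2) down by blast
  \<comment> \<open>Chosen outside the model; \<open>f\<close> is a class map because its graph is
    \<open>T\<close>.\<close>
  define f where "f a = (SOME x. (a, x) \<in> T)" for a
  have f: "(a, f a) \<in> T" if "a \<in> \<Gamma>" for a
    unfolding f_def using T(3)[OF that] by (rule someI_ex)
  have T_iff: "(a, x) \<in> T \<longleftrightarrow> a \<in> \<Gamma> \<and> x = f a" for a x
  proof
    assume ax: "(a, x) \<in> T"
    then have a: "a \<in> \<Gamma>" using T(2) by blast
    then have "(x, f a) \<in> M" "(f a, x) \<in> M"
      using embed[OF ax f] embed[OF f ax] L'(4) by blast+
    with a M'(6) show "a \<in> \<Gamma> \<and> x = f a" by blast
  qed (use f in blast)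
  have "{(x, f x) | x. x \<in> \<Gamma>} = T" using T_iff by auto
  then have "class_map_on \<Gamma> f" using L'(1) T(1) by (simp add: class_map_on_def)
  moreover have "inj_on f \<Gamma>"
  proof (rule inj_onI)
    fix a b assume ab: "a \<in> \<Gamma>" "b \<in> \<Gamma>" "f a = f b"
    then have "(f a, f b) \<in> M" "(f b, f a) \<in> M" using f T(2) M'(4) by auto
    then show "a = b" using embed f ab(1,2) L'(6) by blast
  qed
  moreover have "f ` \<Gamma> = Range T" using T_iff by auto
  moreover have "(a, b) \<in> L \<longleftrightarrow> (f a, f b) \<in> Restr M (Range T)" if "a \<in> \<Gamma>" "b \<in> \<Gamma>" for a b
    using embed[OF f f, OF that] f that by blast
  ultimately have "class_iso \<Gamma> L (Range T) (Restr M (Range T))"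
    unfolding class_iso_def bij_betw_def by blast
  with init show ?thesis unfolding iso_to_initial_segment_def by blast
qed

text \<open>Passing to the converse of \<open>T\<close> exchanges the two orders in the hypotheses,
  which settles the case where \<open>\<Delta>\<close> is exhausted.\<close>

lemma comparableI:
  assumes L: "class_wellorder \<Gamma> L" and M: "class_wellorder \<Delta> M"
    and T: "class_rel T" "T \<subseteq> \<Gamma> \<times> \<Delta>"
    and total: "(\<forall>a \<in> \<Gamma>. \<exists>x. (a, x) \<in> T) \<or> (\<forall>x \<in> \<Delta>. \<exists>a. (a, x) \<in> T)"
    and embed: "\<And>a x b y. (a, x) \<in> T \<Longrightarrow> (b, y) \<in> T \<Longrightarrow> (a, b) \<in> L \<longleftrightarrow> (x, y) \<in> M"
    and down_right: "\<And>a x y. (a, x) \<in> T \<Longrightarrow> (y, x) \<in> M \<Longrightarrow> \<exists>b. (b, y) \<in> T"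
    and down_left: "\<And>a x b. (a, x) \<in> T \<Longrightarrow> (b, a) \<in> L \<Longrightarrow> \<exists>y. (b, y) \<in> T"
  shows "iso_to_initial_segment \<Gamma> L \<Delta> M \<or> iso_to_initial_segment \<Delta> M \<Gamma> L"
  using total
proof
  assume "\<forall>a \<in> \<Gamma>. \<exists>x. (a, x) \<in> T"
  then have "iso_to_initial_segment \<Gamma> L \<Delta> M"
    by (intro iso_to_initial_segmentI[OF L M T]) (use embed down_right in blast)+
  then show ?thesis ..
next
  assume total': "\<forall>x \<in> \<Delta>. \<exists>a. (a, x) \<in> T"
  have "class_rel {(x, a). (a, x) \<in> T}" by (intro class_rel_of_fo fo_intros T)
  moreover have "{(x, a). (a, x) \<in> T} = T\<inverse>" by auto
  ultimately have "class_rel (T\<inverse>)" by simp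
  then have "iso_to_initial_segment \<Delta> M \<Gamma> L"
    by (rule iso_to_initial_segmentI[OF M L]) (use T(2) total' embed down_left in auto)
  then show ?thesis ..
qed

section \<open>Comparability from \<open>ETR\<close>\<close>

lemma ETR_recursion:
  assumes "ETR" "class_wellorder \<Gamma> L" "Z \<in> C" "fo {Z} (\<lambda>s X. P (s 0) X)"
  shows "\<exists>S. class_rel S \<and> S \<subseteq> \<Gamma> \<times> UNIV \<and>
           (\<forall>\<gamma> \<in> \<Gamma>. \<forall>x. (\<gamma>, x) \<in> S \<longleftrightarrow> P x (code (below S L \<gamma>)))"
proof -
  obtain N K where K: "range K \<subseteq> {Z}" "expressed_by N K (\<lambda>s X. P (s 0) X)"
    using fo_expressed_by[OF assms(4)] by auto
  obtain \<phi> where \<phi>: "\<forall>s X. sat s (case_nat X K) \<phi> \<longleftrightarrow> P (s 0) X"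
    using expressed_by_formula[OF K(2), where r = "\<lambda>n. n"] by (rule exE)
  \<comment> \<open>All entries of \<open>K\<close> are \<open>Z\<close>, which yields exactly the
    class valuation of \<open>ETR\<close>.\<close>
  have "(\<lambda>k. if k = 0 then X else Z) = case_nat X K" for X
    using K(1) by (auto simp: fun_eq_iff image_subset_iff split: nat.split)
  then have sat: "sat (\<lambda>_. x) (\<lambda>k. if k = 0 then X else Z) \<phi> \<longleftrightarrow> P x X" for x X
    by (simp add: \<phi>)
  have "\<exists>S. class_rel S \<and> S \<subseteq> \<Gamma> \<times> UNIV \<and>
           (\<forall>\<gamma> \<in> \<Gamma>. S `` {\<gamma>} = {x. P x (code (below S L \<gamma>))})"
    using assms(1,2,3) unfolding ETR_def sat[symmetric] by simp
  then show ?thesis by (auto simp: set_eq_iff)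
qed

lemma comparability_of_ETR:
  assumes "ETR"
  shows "wo_comparability"
  unfolding wo_comparability_def
proof (intro allI impI, elim conjE)
  fix \<Gamma> L \<Delta> M
  assume L: "class_wellorder \<Gamma> L" and M: "class_wellorder \<Delta> M"
  note L' = class_wellorderD[OF L] and M' = class_wellorderD[OF M]
  \<comment> \<open>\<open>?P\<close> makes \<open>x\<close> the least element of
    \<open>\<Delta>\<close> not yet a value. Membership in \<open>\<Delta>\<close> is read off the
    diagonal of \<open>M\<close>, so that \<open>code M\<close> is the only parameter.\<close>
  let ?P = "\<lambda>x X. opair x x \<in> code M \<and> (\<forall>\<alpha>. opair \<alpha> x \<notin> X) \<and>
     (\<forall>y. opair y x \<in> code M \<and> y \<noteq> x \<longrightarrow> (\<exists>\<alpha>. opair \<alpha> y \<in> X))"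
  have P: "fo {code M} (\<lambda>s X. ?P (s 0) X)"
    by (intro fo_intros singletonI)
  obtain S where S: "class_rel S" "S \<subseteq> \<Gamma> \<times> UNIV"
    "\<forall>\<gamma> \<in> \<Gamma>. \<forall>x. (\<gamma>, x) \<in> S \<longleftrightarrow> ?P x (code (below S L \<gamma>))"
    using ETR_recursion[where P = ?P, OF assms L M'(2)[unfolded class_rel_def] P] by (elim exE conjE)
  have S_iff: "(\<gamma>, x) \<in> S \<longleftrightarrow> \<gamma> \<in> \<Gamma> \<and> x \<in> \<Delta> \<and>
      (\<forall>\<alpha>. (\<alpha>, \<gamma>) \<in> L \<longrightarrow> \<alpha> \<noteq> \<gamma> \<longrightarrow> (\<alpha>, x) \<notin> S) \<and>
      (\<forall>y. (y, x) \<in> M \<longrightarrow> y \<noteq> x \<longrightarrow> (\<exists>\<alpha>. (\<alpha>, y) \<in> S \<and> (\<alpha>, \<gamma>) \<in> L \<and> \<alpha> \<noteq> \<gamma>))" for \<gamma> x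
  proof (cases "\<gamma> \<in> \<Gamma>")
    case True
    moreover have "(x, x) \<in> M \<longleftrightarrow> x \<in> \<Delta>" using M'(3,4) by blast
    ultimately show ?thesis using S(3)[rule_format, OF True, of x] unfolding opair_in_code below_def by auto
  qed (use S(2) in blast)
  \<comment> \<open>Were \<open>y\<close> before \<open>x\<close>, stage \<open>a\<close> would
    require \<open>y\<close> to have been used already, and then it would not be free at stage
    \<open>b\<close>.\<close>
  have less: "(x, y) \<in> M \<and> x \<noteq> y"
    if ax: "(a, x) \<in> S" and b_y: "(b, y) \<in> S" and ab: "(a, b) \<in> L" "a \<noteq> b" for a b x y
  proof -
    have "x \<noteq> y" using ax b_y ab S_iff[of b y] by blast
    moreover have "(y, x) \<notin> M"
    proof
      assume "(y, x) \<in> M"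
      then obtain \<alpha> where \<alpha>: "(\<alpha>, y) \<in> S" "(\<alpha>, a) \<in> L" "\<alpha> \<noteq> a"
        using \<open>x \<noteq> y\<close> ax S_iff[of a x] by blast
      then have "(\<alpha>, b) \<in> L" "\<alpha> \<noteq> b" using ab L'(5,6) by blast+
      with \<alpha>(1) b_y show False using S_iff[of b y] by blast
    qed
    ultimately show ?thesis using M'(7) ax b_y S_iff by blast
  qed
  have single_aux: "x = y" if ax: "(a, x) \<in> S" and ay: "(a, y) \<in> S" and xy: "(x, y) \<in> M" for a x y
  proof (rule ccontr)
    assume "x \<noteq> y"
    then obtain \<alpha> where "(\<alpha>, x) \<in> S" "(\<alpha>, a) \<in> L" "\<alpha> \<noteq> a" using ay xy S_iff[of a y] by blast
    with ax show False using S_iff[of a x] by blast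
  qed
  have single: "x = y" if "(a, x) \<in> S" "(a, y) \<in> S" for a x y
  proof -
    have "x \<in> \<Delta>" "y \<in> \<Delta>" using that S_iff by blast+
    then show ?thesis using single_aux[OF that] single_aux[OF that(2,1)] M'(7) by blast
  qed
  show "iso_to_initial_segment \<Gamma> L \<Delta> M \<or> iso_to_initial_segment \<Delta> M \<Gamma> L"
  proof (rule comparableI[OF L M S(1)])
    show "S \<subseteq> \<Gamma> \<times> \<Delta>" using S_iff by auto
    have first_free: "\<exists>y. (a, y) \<in> S"
      if a: "a \<in> \<Gamma>" and x: "x \<in> \<Delta>" "\<And>\<alpha>. (\<alpha>, a) \<in> L \<Longrightarrow> \<alpha> \<noteq> a \<Longrightarrow> (\<alpha>, x) \<notin> S" for a x
    proof -
      let ?A = "{x. x \<in> \<Delta> \<and> (\<forall>\<alpha>. (\<alpha>, a) \<in> L \<longrightarrow> \<alpha> \<noteq> a \<longrightarrow> (\<alpha>, x) \<notin> S)}"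
      have "?A \<in> C" by (intro class_of_fo fo_intros L' M' S)
      moreover have "x \<in> ?A" using x by blast
      ultimately obtain m where m: "m \<in> ?A" "\<forall>b \<in> ?A. (m, b) \<in> M"
        using class_wellorder_least[OF M, of ?A x] by blast
      have "\<exists>\<alpha>. (\<alpha>, y) \<in> S \<and> (\<alpha>, a) \<in> L \<and> \<alpha> \<noteq> a" if "(y, m) \<in> M" "y \<noteq> m" for y
        using m that M'(3,6) by blast
      then have "(a, m) \<in> S" using S_iff[of a m] a m(1) by blast
      then show ?thesis ..
    qed
    \<comment> \<open>If some \<open>a\<close> has no value, then by \<open>first_free\<close> every
      element of \<open>\<Delta>\<close> was used before \<open>a\<close>.\<close>
    show "(\<forall>a \<in> \<Gamma>. \<exists>x. (a, x) \<in> S) \<or> (\<forall>x \<in> \<Delta>. \<exists>a. (a, x) \<in> S)"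
      using first_free by blast
    show "\<exists>b. (b, y) \<in> S" if "(a, x) \<in> S" "(y, x) \<in> M" for a x y
      using that S_iff[of a x] by (cases "y = x") blast+
    \<comment> \<open>What is free at \<open>a\<close> was already free at the earlier
      \<open>b\<close>, so \<open>b\<close> had something to take.\<close>
    show "\<exists>y. (b, y) \<in> S" if ax: "(a, x) \<in> S" and ba: "(b, a) \<in> L" for a x b
    proof (cases "b = a")
      case False
      have "(\<alpha>, x) \<notin> S" if "(\<alpha>, b) \<in> L" "\<alpha> \<noteq> b" for \<alpha>
        using ax S_iff[of a x] L'(5)[OF that(1) ba] L'(6)[of \<alpha> b] that ba by blast
      then show ?thesis using first_free[of b x] ax ba S_iff[of a x] L'(3) by blast
    qed (use ax in blast)
    show "(a, b) \<in> L \<longleftrightarrow> (x, y) \<in> M" if ax: "(a, x) \<in> S" and b_y: "(b, y) \<in> S" for a x b y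
    proof -
      have ab: "a \<in> \<Gamma>" "b \<in> \<Gamma>" "x \<in> \<Delta>" "y \<in> \<Delta>" using ax b_y S_iff by blast+
      consider "a = b" | "(a, b) \<in> L" "a \<noteq> b" | "(b, a) \<in> L" "a \<noteq> b" using L'(7) ab by blast
      then show ?thesis
      proof cases
        case 1
        then show ?thesis using single[of a x y] ax b_y ab L'(4) M'(4) by simp
      next
        case 2
        then show ?thesis using less[OF ax b_y] by blast
      next
        case 3
        then have "(y, x) \<in> M" "y \<noteq> x" using less[OF b_y ax] by auto
        then show ?thesis using 3 L'(6) M'(6) by blast
      qed
    qed
  qed
qed

section \<open>Comparability from continuous rankings\<close>

text \<open>Abstracts one summand of the ranked relation, with \<open>t\<close> as the rank of the
  bottom element. Continuity forbids gaps: for the \<open>L\<close>-least \<open>m\<close> with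
  \<open>h m\<close> at or above \<open>\<theta>\<close>, all earlier values lie strictly below
  \<open>\<theta>\<close>, so \<open>\<theta>\<close> is itself a strict upper bound and leastness
  gives \<open>h m = \<theta>\<close>.\<close>

lemma
  fixes h :: "'v \<Rightarrow> 'v"
  assumes L: "class_wellorder \<Gamma> L" and N: "class_wellorder \<Theta> N"
    and h: "class_rel {(b, y). b \<in> \<Gamma> \<and> y = h b}"
    and upper: "\<And>b. b \<in> \<Gamma> \<Longrightarrow> h b \<in> strict_upper_bounds \<Theta> N (insert t (h ` {a \<in> \<Gamma>. (a, b) \<in> L - Id}))"
    and least: "\<And>b g. b \<in> \<Gamma> \<Longrightarrow>
      g \<in> strict_upper_bounds \<Theta> N (insert t (h ` {a \<in> \<Gamma>. (a, b) \<in> L - Id})) \<Longrightarrow> (h b, g) \<in> N"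
  shows continuous_embedding: "a \<in> \<Gamma> \<Longrightarrow> b \<in> \<Gamma> \<Longrightarrow> (a, b) \<in> L \<longleftrightarrow> (h a, h b) \<in> N"
    and continuous_downward_closed:
      "b \<in> \<Gamma> \<Longrightarrow> (t, \<theta>) \<in> N - Id \<Longrightarrow> (\<theta>, h b) \<in> N \<Longrightarrow> \<exists>a \<in> \<Gamma>. h a = \<theta>"
proof -
  note L' = class_wellorderD[OF L] and N' = class_wellorderD[OF N]
  have less: "(h a, h b) \<in> N - Id" if "a \<in> \<Gamma>" "b \<in> \<Gamma>" "(a, b) \<in> L - Id" for a b
    using upper[OF that(2)] that unfolding strict_upper_bounds_def by blast
  have h_in: "h a \<in> \<Theta>" if "a \<in> \<Gamma>" for a
    using upper[OF that] unfolding strict_upper_bounds_def by blast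
  show "(a, b) \<in> L \<longleftrightarrow> (h a, h b) \<in> N" if ab: "a \<in> \<Gamma>" "b \<in> \<Gamma>"
  proof (cases "a = b")
    case True
    then show ?thesis using L'(4) N'(4) h_in ab by simp
  next
    case False
    then show ?thesis using less[OF ab] less[OF ab(2,1)] L'(7)[OF ab] N'(6)[of "h a" "h b"] by auto
  qed
  show "\<exists>a \<in> \<Gamma>. h a = \<theta>" if b: "b \<in> \<Gamma>" and \<theta>: "(t, \<theta>) \<in> N - Id" "(\<theta>, h b) \<in> N"
  proof -
    let ?A = "{a. \<exists>y. (a, y) \<in> {(b, y). b \<in> \<Gamma> \<and> y = h b} \<and> (\<theta>, y) \<in> N}"
    have A: "?A = {a \<in> \<Gamma>. (\<theta>, h a) \<in> N}" by auto
    have "?A \<in> C" by (intro class_of_fo fo_intros h N')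
    then obtain m where m: "m \<in> \<Gamma>" "(\<theta>, h m) \<in> N"
      and m_least: "\<And>a. a \<in> \<Gamma> \<Longrightarrow> (\<theta>, h a) \<in> N \<Longrightarrow> (m, a) \<in> L"
      using class_wellorder_least[OF L, of ?A b] b \<theta> unfolding A by blast
    have "(h a, \<theta>) \<in> N - Id" if "a \<in> \<Gamma>" "(a, m) \<in> L - Id" for a
    proof -
      have "(\<theta>, h a) \<notin> N" using m_least[of a] that L'(6)[of a m] by blast
      then show ?thesis using N'(3,4,7) h_in[OF that(1)] \<theta> by blast
    qed
    then have "\<theta> \<in> strict_upper_bounds \<Theta> N (insert t (h ` {a \<in> \<Gamma>. (a, m) \<in> L - Id}))"
      using \<theta> N'(3) unfolding strict_upper_bounds_def by blast
    from least[OF m(1) this] have "h m = \<theta>" using m(2) N'(6) by blast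
    with m(1) show ?thesis by blast
  qed
qed

lemma comparability_of_continuous_rankings:
  assumes "wf_rels_have_continuous_rankings"
  shows "wo_comparability"
  unfolding wo_comparability_def
proof (intro allI impI, elim conjE)
  fix \<Gamma> L \<Delta> M
  assume L: "class_wellorder \<Gamma> L" and M: "class_wellorder \<Delta> M"
  note L' = class_wellorderD[OF L] and M' = class_wellorderD[OF M]
  obtain c0 where c0: "ext c0 = {}" using infinity by blast
  \<comment> \<open>Three distinct sets serve as tags: \<open>c0\<close> marks the copy of
    \<open>\<Gamma>\<close>, \<open>c1\<close> the copy of \<open>\<Delta>\<close>, and
    \<open>opair c2 c2\<close> is the bottom.\<close>
  define c1 where "c1 = upair c0 c0"
  define c2 where "c2 = upair c1 c1"
  have "c0 \<epsilon> c1" "c1 \<epsilon> c2" "\<not> c1 \<epsilon> c0" "\<not> c1 \<epsilon> c1"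
    using c0 not_mem_self by (auto simp: c1_def c2_def mem_upair ext_def)
  then have c: "c0 \<noteq> c1" "c0 \<noteq> c2" "c1 \<noteq> c2" by metis+
  define R where "R = {(p, q).
    (\<exists>a b. (a, b) \<in> L \<and> a \<noteq> b \<and> p = opair a c0 \<and> q = opair b c0) \<or>
    (\<exists>a b. (a, b) \<in> M \<and> a \<noteq> b \<and> p = opair a c1 \<and> q = opair b c1) \<or>
    p = opair c2 c2 \<and> ((\<exists>b. b \<in> \<Gamma> \<and> q = opair b c0) \<or> (\<exists>b. b \<in> \<Delta> \<and> q = opair b c1))}"
  have R: "class_rel R" unfolding R_def by (intro class_rel_of_fo fo_intros L' M')
  have R0: "(p, opair b c0) \<in> R \<longleftrightarrow>
      b \<in> \<Gamma> \<and> (p = opair c2 c2 \<or> (\<exists>a. a \<in> \<Gamma> \<and> (a, b) \<in> L - Id \<and> p = opair a c0))" for p b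
    unfolding R_def using c L'(3) by auto
  have R1: "(p, opair b c1) \<in> R \<longleftrightarrow>
      b \<in> \<Delta> \<and> (p = opair c2 c2 \<or> (\<exists>a. a \<in> \<Delta> \<and> (a, b) \<in> M - Id \<and> p = opair a c1))" for p b
    unfolding R_def using c M'(3) by auto
  have R2: "(p, opair c2 c2) \<notin> R" for p
    unfolding R_def using c by auto
  have "wf_class_on (Field R) R"
    unfolding wf_class_on_def
  proof (intro allI impI, elim conjE)
    fix a assume a: "ext a \<noteq> {}" "ext a \<subseteq> Field R"
    show "\<exists>m \<in> ext a. \<forall>b \<in> ext a. (b, m) \<notin> R"
    proof (cases "opair c2 c2 \<epsilon> a")
      case True
      with R2 show ?thesis unfolding ext_def by blast
    next
      case no_bottom: False
      have mem: "\<exists>b. (b \<in> \<Gamma> \<and> p = opair b c0) \<or> (b \<in> \<Delta> \<and> p = opair b c1)" if "p \<epsilon> a" for p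
        using that a(2) no_bottom L'(3) M'(3) unfolding R_def Field_def ext_def by blast
      \<comment> \<open>The two summands are unrelated, so a least element within one of them is
        minimal in all of \<open>a\<close>.\<close>
      have "\<exists>m. m \<epsilon> a \<and> (\<forall>p. p \<epsilon> a \<longrightarrow> (p, m) \<notin> R)"
      proof (cases "\<exists>x. x \<in> \<Gamma> \<and> opair x c0 \<epsilon> a")
        case True
        let ?A = "{x. x \<in> \<Gamma> \<and> opair x c0 \<epsilon> a}"
        obtain x0 where "x0 \<in> ?A" using True by blast
        moreover have "?A \<in> C" by (intro class_of_fo fo_intros L')
        moreover have "?A \<subseteq> \<Gamma>" by blast
        ultimately have "\<exists>m \<in> ?A. \<forall>b \<in> ?A. (m, b) \<in> L"
          by (intro class_wellorder_least[OF L])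
        then obtain m where m: "m \<in> ?A" "\<forall>b \<in> ?A. (m, b) \<in> L" by (rule bexE)
        have "(p, opair m c0) \<notin> R" if "p \<epsilon> a" for p
        proof
          assume "(p, opair m c0) \<in> R"
          then obtain x where x: "x \<in> \<Gamma>" "(x, m) \<in> L - Id" "p = opair x c0"
            using R0[of p m] no_bottom \<open>p \<epsilon> a\<close> by auto
          with m(2) \<open>p \<epsilon> a\<close> x(1,3) have "(m, x) \<in> L" by blast
          with x(2) L'(6)[of m x] show False by blast
        qed
        with m(1) show ?thesis by blast
      next
        case False
        let ?A = "{x. x \<in> \<Delta> \<and> opair x c1 \<epsilon> a}"
        obtain p where "p \<epsilon> a" using a(1) by (auto simp: ext_def)
        then obtain x0 where "x0 \<in> ?A" using mem False by blast
        moreover have "?A \<in> C" by (intro class_of_fo fo_intros M')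
        moreover have "?A \<subseteq> \<Delta>" by blast
        ultimately have "\<exists>m \<in> ?A. \<forall>b \<in> ?A. (m, b) \<in> M"
          by (intro class_wellorder_least[OF M])
        then obtain m where m: "m \<in> ?A" "\<forall>b \<in> ?A. (m, b) \<in> M" by (rule bexE)
        have "(p, opair m c1) \<notin> R" if "p \<epsilon> a" for p
        proof
          assume "(p, opair m c1) \<in> R"
          then obtain x where x: "x \<in> \<Delta>" "(x, m) \<in> M - Id" "p = opair x c1"
            using R1[of p m] no_bottom \<open>p \<epsilon> a\<close> by auto
          with m(2) \<open>p \<epsilon> a\<close> x(1,3) have "(m, x) \<in> M" by blast
          with x(2) M'(6)[of m x] show False by blast
        qed
        with m(1) show ?thesis by blast
      qed
      then show ?thesis by (simp add: ext_def)
    qed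
  qed
  with R have "wf_class_rel R" by (simp add: wf_class_rel_def)
  then obtain \<Theta> N \<pi> where N: "class_wellorder \<Theta> N" and \<pi>: "continuous_ranking (Field R) R \<Theta> N \<pi>"
    using assms unfolding wf_rels_have_continuous_rankings_def by blast
  note N' = class_wellorderD[OF N]
  let ?U = "\<lambda>b. strict_upper_bounds \<Theta> N (\<pi> ` {a \<in> Field R. (a, b) \<in> R})"
  define G where "G = {(x, \<pi> x) | x. x \<in> Field R}"
  have G: "class_rel G"
    using \<pi> unfolding continuous_ranking_def ranking_def class_map_on_def G_def by blast
  have \<pi>_upper: "\<pi> b \<in> ?U b" and \<pi>_least: "\<And>g. g \<in> ?U b \<Longrightarrow> (\<pi> b, g) \<in> N" if "b \<in> Field R" for b
    using \<pi> that unfolding continuous_ranking_def Let_def by blast+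
  define h where "h b = \<pi> (opair b c0)" for b
  define k where "k b = \<pi> (opair b c1)" for b
  define t where "t = \<pi> (opair c2 c2)"
  have field0: "opair b c0 \<in> Field R" if "b \<in> \<Gamma>" for b
    using R0[of "opair c2 c2" b] that by (auto intro: FieldI2)
  have field1: "opair b c1 \<in> Field R" if "b \<in> \<Delta>" for b
    using R1[of "opair c2 c2" b] that by (auto intro: FieldI2)
  \<comment> \<open>Turns continuity of \<open>\<pi>\<close> at a tagged element into the hypotheses
    on \<open>h\<close>; the bottom below that element contributes \<open>t\<close>.\<close>
  have pred0: "\<pi> ` {a \<in> Field R. (a, opair b c0) \<in> R} = insert t (h ` {a \<in> \<Gamma>. (a, b) \<in> L - Id})"
    if b: "b \<in> \<Gamma>" for b
  proof -
    have "{a \<in> Field R. (a, opair b c0) \<in> R} =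
        insert (opair c2 c2) ((\<lambda>a. opair a c0) ` {a \<in> \<Gamma>. (a, b) \<in> L - Id})"
      using b R0[of _ b] by (auto simp: set_eq_iff Field_def)
    then show ?thesis by (simp add: image_image h_def t_def)
  qed
  have pred1: "\<pi> ` {a \<in> Field R. (a, opair b c1) \<in> R} = insert t (k ` {a \<in> \<Delta>. (a, b) \<in> M - Id})"
    if b: "b \<in> \<Delta>" for b
  proof -
    have "{a \<in> Field R. (a, opair b c1) \<in> R} =
        insert (opair c2 c2) ((\<lambda>a. opair a c1) ` {a \<in> \<Delta>. (a, b) \<in> M - Id})"
      using b R1[of _ b] by (auto simp: set_eq_iff Field_def)
    then show ?thesis by (simp add: image_image k_def t_def)
  qed
  have "class_rel {(b, y). b \<in> \<Gamma> \<and> (opair b c0, y) \<in> G}"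
    by (intro class_rel_of_fo fo_intros L' G)
  moreover have "{(b, y). b \<in> \<Gamma> \<and> (opair b c0, y) \<in> G} = {(b, y). b \<in> \<Gamma> \<and> y = h b}"
    using field0 by (auto simp: G_def h_def)
  ultimately have h: "class_rel {(b, y). b \<in> \<Gamma> \<and> y = h b}" by simp
  have "class_rel {(b, y). b \<in> \<Delta> \<and> (opair b c1, y) \<in> G}"
    by (intro class_rel_of_fo fo_intros M' G)
  moreover have "{(b, y). b \<in> \<Delta> \<and> (opair b c1, y) \<in> G} = {(b, y). b \<in> \<Delta> \<and> y = k b}"
    using field1 by (auto simp: G_def k_def)
  ultimately have k: "class_rel {(b, y). b \<in> \<Delta> \<and> y = k b}" by simp
  have h_upper: "h b \<in> strict_upper_bounds \<Theta> N (insert t (h ` {a \<in> \<Gamma>. (a, b) \<in> L - Id}))"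
    and h_least: "\<And>g. g \<in> strict_upper_bounds \<Theta> N (insert t (h ` {a \<in> \<Gamma>. (a, b) \<in> L - Id}))
      \<Longrightarrow> (h b, g) \<in> N" if "b \<in> \<Gamma>" for b
    using \<pi>_upper[OF field0[OF that]] \<pi>_least[OF field0[OF that]]
    unfolding pred0[OF that] h_def[symmetric] by blast+
  have k_upper: "k b \<in> strict_upper_bounds \<Theta> N (insert t (k ` {a \<in> \<Delta>. (a, b) \<in> M - Id}))"
    and k_least: "\<And>g. g \<in> strict_upper_bounds \<Theta> N (insert t (k ` {a \<in> \<Delta>. (a, b) \<in> M - Id}))
      \<Longrightarrow> (k b, g) \<in> N" if "b \<in> \<Delta>" for b
    using \<pi>_upper[OF field1[OF that]] \<pi>_least[OF field1[OF that]]
    unfolding pred1[OF that] k_def[symmetric] by blast+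
  have h_above: "h b \<in> \<Theta> \<and> (t, h b) \<in> N - Id" if "b \<in> \<Gamma>" for b
    using h_upper[OF that] unfolding strict_upper_bounds_def by blast
  have k_above: "k b \<in> \<Theta> \<and> (t, k b) \<in> N - Id" if "b \<in> \<Delta>" for b
    using k_upper[OF that] unfolding strict_upper_bounds_def by blast
  note h_emb = continuous_embedding[OF L N h h_upper h_least]
    and h_down = continuous_downward_closed[OF L N h h_upper h_least]
    and k_emb = continuous_embedding[OF M N k k_upper k_least]
    and k_down = continuous_downward_closed[OF M N k k_upper k_least]
  \<comment> \<open>Matches elements of equal rank, phrased through the graphs of \<open>h\<close>
    and \<open>k\<close> to be definable.\<close>
  define T where "T = {(a, x). \<exists>y. (a, y) \<in> {(b, y). b \<in> \<Gamma> \<and> y = h b} \<and>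
                                 (x, y) \<in> {(b, y). b \<in> \<Delta> \<and> y = k b}}"
  have T_iff: "(a, x) \<in> T \<longleftrightarrow> a \<in> \<Gamma> \<and> x \<in> \<Delta> \<and> h a = k x" for a x
    unfolding T_def by auto
  show "iso_to_initial_segment \<Gamma> L \<Delta> M \<or> iso_to_initial_segment \<Delta> M \<Gamma> L"
  proof (rule comparableI[OF L M])
    show "class_rel T" unfolding T_def by (intro class_rel_of_fo fo_intros h k)
    show "T \<subseteq> \<Gamma> \<times> \<Delta>" using T_iff by auto
    show "(\<forall>a \<in> \<Gamma>. \<exists>x. (a, x) \<in> T) \<or> (\<forall>x \<in> \<Delta>. \<exists>a. (a, x) \<in> T)"
    proof (rule ccontr)
      assume "\<not> ?thesis"
      then obtain a x where ax: "a \<in> \<Gamma>" "x \<in> \<Delta>" "\<And>y. (a, y) \<notin> T" "\<And>b. (b, x) \<notin> T" by blast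
      \<comment> \<open>The smaller of the two ranks lies above \<open>t\<close> and at or below the
        other, so it is attained in the other order as well, against the choice of \<open>a\<close>
        and \<open>x\<close>.\<close>
      from N'(7)[of "h a" "k x"] h_above[OF ax(1)] k_above[OF ax(2)]
      consider "(h a, k x) \<in> N" | "(k x, h a) \<in> N" by blast
      then show False
      proof cases
        case 1
        then obtain y where "y \<in> \<Delta>" "k y = h a"
          using k_down[OF _ _ _ ax(2)] h_above[OF ax(1)] by blast
        with ax(1,3) T_iff show False by metis
      next
        case 2
        then obtain b where "b \<in> \<Gamma>" "h b = k x"
          using h_down[OF _ _ _ ax(1)] k_above[OF ax(2)] by blast
        with ax(2,4) T_iff show False by metis
      qed
    qed
    show "(a, b) \<in> L \<longleftrightarrow> (x, y) \<in> M" if "(a, x) \<in> T" "(b, y) \<in> T" for a x b y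
      using that h_emb[of a b] k_emb[of x y] unfolding T_iff by simp
    show "\<exists>b. (b, y) \<in> T" if ax: "(a, x) \<in> T" and yx: "(y, x) \<in> M" for a x y
    proof -
      have y: "y \<in> \<Delta>" using yx M'(3) by blast
      then have "(k y, h a) \<in> N" using ax yx k_emb[of y x] unfolding T_iff by simp
      then obtain b where "b \<in> \<Gamma>" "h b = k y"
        using h_down[of a "k y"] k_above[OF y] ax unfolding T_iff by blast
      with y T_iff show ?thesis by blast
    qed
    show "\<exists>y. (b, y) \<in> T" if ax: "(a, x) \<in> T" and ba: "(b, a) \<in> L" for a x b
    proof -
      have b: "b \<in> \<Gamma>" using ba L'(3) by blast
      then have "(h b, k x) \<in> N" using ax ba h_emb[of b a] unfolding T_iff by simp
      then obtain y where "y \<in> \<Delta>" "k y = h b"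
        using k_down[of x "h b"] h_above[OF b] ax unfolding T_iff by blast
      with b T_iff show ?thesis by metis
    qed
  qed
qed

end

theorem theorem6:
  fixes E :: "'v \<Rightarrow> 'v \<Rightarrow> bool" and C :: "'v set set"
  assumes "GBC_minus E C"
  shows "(class_structure.ETR E C \<longrightarrow> class_structure.wo_comparability E C) \<and>
         (class_structure.wf_rels_have_continuous_rankings E C \<longrightarrow>
            class_structure.wo_comparability E C)"
  using GBC_minus.comparability_of_ETR[OF assms]
    GBC_minus.comparability_of_continuous_rankings[OF assms] by blast

end
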